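(* Let $\mathcal{A},\mathcal{B}\subseteq\mathbb{N}^{\mathbb{N}}$. Then $$\mathcal{A}\leq_{\mathrm M}\mathcal{B}\iff c_{\mathcal{A}}\leq_{\mathrm W}c_{\mathcal{B}}.$$
   Context: Medvedev reducibility: $\mathcal{A}\leq_{\mathrm M}\mathcal{B}$ iff there is a computable partial function $F:\subseteq\mathbb{N}^{\mathbb{N}}\to\mathbb{N}^{\mathbb{N}}$ with $\mathcal{B}\subseteq\mathrm{dom}(F)$ and $F(\mathcal{B})\subseteq\mathcal{A}$. For non-empty $\mathcal{A}\subseteq\mathbb{N}^{\mathbb{N}}$, $c_{\mathcal{A}}:\mathbb{N}^{\mathbb{N}}\rightrightarrows\mathbb{N}^{\mathbb{N}}$ is the constant multi-valued function $c_{\mathcal{A}}(p)=\mathcal{A}$ for all $p$. Its realizers are the partial functions $G:\subseteq\mathbb{N}^{\mathbb{N}}\to\mathbb{N}^{\mathbb{N}}$ defined on all of $\mathbb{N}^{\mathbb{N}}$ with $G(p)\in\mathcal{A}$ for all $p$ ($\mathbb{N}^{\mathbb{N}}$ is represented by the identity). For $\mathcal{A}=\emptyset$, $c_{\emptyset}:=\boldsymbol{\emptyset}$ is a special object whose set of realizers is declared to be empty. Weihrauch reducibility: $f\leq_{\mathrm W}g$ iff there are computable $H,K:\subseteq\mathbb{N}^{\mathbb{N}}\to\mathbb{N}^{\mathbb{N}}$ such that for every realizer $G$ of $g$ the function $p\mapsto H\langle p,GK(p)\rangle$ is a realizer of $f$, where $\langle\cdot,\cdot\rangle$ is a computable standard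 pairing function on $\mathbb{N}^{\mathbb{N}}$. *)

theory Defs
  imports Main
begin

type_synonym baire = "nat \<Rightarrow> nat"

text \<open>
  Computability on Baire space is that of Turing functionals, presented by partial recursive
  functions relative to a point of Baire space, whose values \<open>Query\<close> looks up. Programs take a
  list of arguments; in \<open>PRec f g\<close> the recursion variable is the first argument, and \<open>g\<close>
  receives the predecessor, the previous value and the parameters, in this order. A program
  applied to a list of the wrong length may be undefined or ignore surplus arguments.
\<close>

datatype orec =
    Zero
  | Succ
  | Proj nat
  | Query
  | Comp orec "orec list"
  | PRec orec orec
  | Mu orec

inductive oeval :: "baire \<Rightarrow> orec \<Rightarrow> nat list \<Rightarrow> nat \<Rightarrow> bool" for p :: baire where
  Zero: "oeval p Zero xs 0"
| Succ: "oeval p Succ [x] (Suc x)"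
| Proj: "i < length xs \<Longrightarrow> oeval p (Proj i) xs (xs ! i)"
| Query: "oeval p Query [x] (p x)"
| Comp: "list_all2 (\<lambda>g y. oeval p g xs y) gs ys \<Longrightarrow> oeval p f ys z \<Longrightarrow> oeval p (Comp f gs) xs z"
| PRec_0: "oeval p f xs y \<Longrightarrow> oeval p (PRec f g) (0 # xs) y"
| PRec_Suc: "oeval p (PRec f g) (n # xs) y \<Longrightarrow> oeval p g (n # y # xs) z \<Longrightarrow>
    oeval p (PRec f g) (Suc n # xs) z"
| Mu: "oeval p f (n # xs) 0 \<Longrightarrow> (\<And>i. i < n \<Longrightarrow> \<exists>y. oeval p f (i # xs) (Suc y)) \<Longrightarrow>
    oeval p (Mu f) xs n"

text \<open>
  As usual in computable analysis, the program only has to be correct on the domain of the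
  partial function; nothing is required of it elsewhere.
\<close>

definition computable :: "(baire \<rightharpoonup> baire) \<Rightarrow> bool" where
  "computable F \<longleftrightarrow> (\<exists>e. \<forall>p q. F p = Some q \<longrightarrow> (\<forall>n. oeval p e [n] (q n)))"

definition medvedev_le :: "baire set \<Rightarrow> baire set \<Rightarrow> bool" (infix \<open>\<le>\<^sub>M\<close> 50) where
  "A \<le>\<^sub>M B \<longleftrightarrow> (\<exists>F. computable F \<and> B \<subseteq> dom F \<and> (\<forall>p\<in>B. \<forall>q. F p = Some q \<longrightarrow> q \<in> A))"

definition baire_pair :: "baire \<Rightarrow> baire \<Rightarrow> baire" where
  "baire_pair p q = (\<lambda>n. if even n then p (n div 2) else q (n div 2))"

text \<open>
  A partial multi-valued function is encoded as a set-valued function, with value \<open>{}\<close> outside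
  its domain. \<open>Bold_Empty\<close> is the special object that has no realizer; it differs from
  \<open>Mv (\<lambda>_. {})\<close>, the nowhere defined multi-valued function, of which every partial function
  is a realizer.
\<close>

datatype mv_problem =
    Bold_Empty
  | Mv "baire \<Rightarrow> baire set"

fun mv_realizers :: "mv_problem \<Rightarrow> (baire \<rightharpoonup> baire) set" where
  "mv_realizers Bold_Empty = {}"
| "mv_realizers (Mv f) = {G. \<forall>p. f p \<noteq> {} \<longrightarrow> (\<exists>q\<in>f p. G p = Some q)}"

definition weihrauch_le :: "mv_problem \<Rightarrow> mv_problem \<Rightarrow> bool" (infix \<open>\<le>\<^sub>W\<close> 50) where
  "f \<le>\<^sub>W g \<longleftrightarrow> (\<exists>H K. computable H \<and> computable K \<and>
     (\<forall>G\<in>mv_realizers g.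
        (\<lambda>p. Option.bind ((G \<circ>\<^sub>m K) p) (\<lambda>q. H (baire_pair p q))) \<in> mv_realizers f))"

definition const_mv :: "baire set \<Rightarrow> mv_problem" where
  "const_mv A = (if A = {} then Bold_Empty else Mv (\<lambda>_. A))"

lemma mv_realizers_const_mv:
  assumes "A \<noteq> {}"
  shows "mv_realizers (const_mv A) = {G. dom G = UNIV \<and> ran G \<subseteq> A}"
proof (intro set_eqI iffI)
  fix G assume "G \<in> mv_realizers (const_mv A)"
  then have *: "\<exists>q\<in>A. G p = Some q" for p
    using assms by (simp add: const_mv_def)
  then show "G \<in> {G. dom G = UNIV \<and> ran G \<subseteq> A}"
    by (auto simp: ran_def dom_def) (metis option.distinct(1) option.inject)+
next
  fix G :: "baire \<rightharpoonup> baire" assume *: "G \<in> {G. dom G = UNIV \<and> ran G \<subseteq> A}"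
  have "\<exists>q\<in>A. G p = Some q" for p
  proof -
    have "p \<in> dom G" using * by simp
    then obtain q where "G p = Some q" by blast
    with * show ?thesis by (auto intro: ranI)
  qed
  then show "G \<in> mv_realizers (const_mv A)"
    using assms by (simp add: const_mv_def)
qed

end

theory Submission
  imports Defs
begin

text \<open>
  A realizer of \<open>const_mv B\<close> may ignore its input and return any fixed point of \<open>B\<close>, and an
  answer to \<open>const_mv A\<close> is correct for every input as soon as it lies in \<open>A\<close>. So the inner
  reduction and the original input carry no information, and only the outer reduction \<open>H\<close>
  matters.

  Given a Medvedev reduction \<open>F\<close>, the outer reduction drops the original input and applies \<open>F\<close>
  to the point of \<open>B\<close> that it receives, \<open>H \<langle>p, q\<rangle> = F q\<close>, while the inner one is the identity.
  Conversely, given \<open>H\<close>, some input has to be supplied to it along with the point \<open>q\<close> of \<open>B\<close>.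
  Every input is as good as any other, and the point \<open>q\<close> itself is one, so \<open>F q = H \<langle>q, q\<rangle>\<close>
  is a Medvedev reduction; this follows by applying the Weihrauch reduction to the realizer that
  is constantly \<open>q\<close>. The diagonal has the advantage that \<open>\<langle>q, q\<rangle> n = q (n div 2)\<close>, without a
  case distinction.

  Both functions thus arise by composing a computable function with a change of oracle that is
  given by a total program. They are computable because the program for the new oracle can be
  substituted for the oracle queries (\<open>computable_comp_oracle\<close>).

  The empty set needs separate treatment. If \<open>B\<close> is empty, then both sides hold, since the
  requirements on the reductions are void. If \<open>A\<close> is empty and \<open>B\<close> is not, then both fail: there
  is no point to send those of \<open>B\<close> to, and \<open>const_mv B\<close> has a realizer but \<open>const_mv A\<close> has none.
\<close>

primrec subst_query :: "orec \<Rightarrow> orec \<Rightarrow> orec" where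
  "subst_query d Zero = Zero"
| "subst_query d Succ = Succ"
| "subst_query d (Proj i) = Proj i"
| "subst_query d Query = d"
| "subst_query d (Comp f gs) = Comp (subst_query d f) (map (subst_query d) gs)"
| "subst_query d (PRec f g) = PRec (subst_query d f) (subst_query d g)"
| "subst_query d (Mu f) = Mu (subst_query d f)"

lemma oeval_subst_query:
  assumes "oeval r e xs y" and d: "\<And>m. oeval p d [m] (r m)"
  shows "oeval p (subst_query d e) xs y"
  using assms(1)
proof induction
  case (Comp xs gs ys f z)
  have "list_all2 (\<lambda>g y. oeval p g xs y) (map (subst_query d) gs) ys"
    using Comp.IH(1) by (auto simp: list_all2_map1 elim: list_all2_mono)
  then show ?case
    using Comp.IH(2) by (auto intro: oeval.Comp)
next
  case (Mu f n xs)
  have "oeval p (Mu (subst_query d f)) xs n"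
  proof (rule oeval.Mu)
    show "oeval p (subst_query d f) (n # xs) 0"
      by (rule Mu.IH)
    show "\<exists>y. oeval p (subst_query d f) (i # xs) (Suc y)" if "i < n" for i
      using Mu.IH(2)[OF that] by blast
  qed
  then show ?case
    by simp
qed (auto intro: oeval.intros d)

lemma computable_comp_oracle:
  assumes "computable F" and "\<And>p n. oeval p d [n] (\<Phi> p n)"
  shows "computable (\<lambda>p. F (\<Phi> p))"
  using assms oeval_subst_query unfolding computable_def by meson

lemma computable_empty: "computable Map.empty"
  by (simp add: computable_def)

lemma computable_Some: "computable Some"
  using oeval.Query by (auto simp: computable_def)

lemma oeval_Comp1:
  "oeval p g xs y \<Longrightarrow> oeval p f [y] z \<Longrightarrow> oeval p (Comp f [g]) xs z"
  by (rule oeval.Comp[of _ _ _ "[y]"]) auto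

lemma oeval_Comp2:
  "oeval p g xs y \<Longrightarrow> oeval p h xs y' \<Longrightarrow> oeval p f [y, y'] z \<Longrightarrow> oeval p (Comp f [g, h]) xs z"
  by (rule oeval.Comp[of _ _ _ "[y, y']"]) auto

lemma oeval_Proj_0: "oeval p (Proj 0) (x # xs) x"
  using oeval.Proj[of 0 "x # xs"] by simp

lemma oeval_Proj_1: "oeval p (Proj 1) (x # y # xs) y"
  using oeval.Proj[of 1 "x # y # xs"] by simp

definition odd_prog :: orec where
  "odd_prog = PRec (Comp Succ [Zero]) (Comp Succ [Comp Succ [Proj 1]])"

lemma oeval_odd_prog: "oeval p odd_prog [n] (Suc (2 * n))"
  unfolding odd_prog_def
proof (induction n)
  case 0
  show ?case
    by (auto intro!: oeval.PRec_0 oeval_Comp1 intro: oeval.intros)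
next
  case (Suc n)
  then show ?case
    by (auto intro!: oeval_Comp1 oeval_Proj_1[unfolded One_nat_def]
        intro: oeval.PRec_Suc oeval.Succ)
qed

definition pred_prog :: orec where
  "pred_prog = PRec Zero (Proj 0)"

lemma oeval_pred_prog: "oeval p pred_prog [n] (n - 1)"
  unfolding pred_prog_def
proof (induction n)
  case 0
  show ?case
    by (auto intro: oeval.intros)
next
  case (Suc n)
  then show ?case
    using oeval.PRec_Suc oeval_Proj_0 by fastforce
qed

text \<open>
  The subtrahend is the first argument, as it is the variable of the recursion.
\<close>

definition diff_prog :: orec where
  "diff_prog = PRec (Proj 0) (Comp pred_prog [Proj 1])"

lemma oeval_diff_prog: "oeval p diff_prog [k, m] (m - k)"
  unfolding diff_prog_def
proof (induction k)
  case 0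
  show ?case
    by (simp add: oeval.PRec_0 oeval_Proj_0)
next
  case (Suc k)
  have "oeval p (Comp pred_prog [Proj 1]) [k, m - k, m] (m - Suc k)"
    using oeval_Comp1[OF oeval_Proj_1 oeval_pred_prog] by (metis diff_Suc_eq_diff_pred diff_commute)
  with Suc show ?case
    by (rule oeval.PRec_Suc)
qed

text \<open>
  Halving is a primitive recursion without case distinction because \<open>n\<close> is the sum of its halves
  rounded down and up, so that \<open>Suc n div 2 = n - n div 2\<close>.
\<close>

definition half_prog :: orec where
  "half_prog = PRec Zero (Comp diff_prog [Proj 1, Proj 0])"

lemma oeval_half_prog: "oeval p half_prog [n] (n div 2)"
  unfolding half_prog_def
proof (induction n)
  case 0
  show ?case
    by (auto intro: oeval.intros)
next
  case (Suc n)
  have "n - n div 2 = Suc n div 2"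
    by presburger
  then have "oeval p (Comp diff_prog [Proj 1, Proj 0]) [n, n div 2] (Suc n div 2)"
    using oeval_Comp2[OF oeval_Proj_1 oeval_Proj_0 oeval_diff_prog] by metis
  with Suc show ?case
    by (rule oeval.PRec_Suc)
qed

definition baire_snd :: "baire \<Rightarrow> baire" where
  "baire_snd r = (\<lambda>n. r (Suc (2 * n)))"

lemma baire_snd_pair [simp]: "baire_snd (baire_pair p q) = q"
  by (simp add: baire_snd_def baire_pair_def)

lemma computable_comp_baire_snd:
  assumes "computable F"
  shows "computable (\<lambda>r. F (baire_snd r))"
  using assms
proof (rule computable_comp_oracle)
  show "oeval r (Comp Query [odd_prog]) [n] (baire_snd r n)" for r n
    unfolding baire_snd_def using oeval_odd_prog oeval.Query by (rule oeval_Comp1)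
qed

lemma computable_comp_diagonal:
  assumes "computable H"
  shows "computable (\<lambda>q. H (baire_pair q q))"
  using assms
proof (rule computable_comp_oracle)
  show "oeval q (Comp Query [half_prog]) [n] (baire_pair q q n)" for q n
    using oeval_Comp1[OF oeval_half_prog oeval.Query] by (simp add: baire_pair_def)
qed

lemma medvedev_le_empty: "A \<le>\<^sub>M {}"
  using computable_empty by (auto simp: medvedev_le_def)

lemma weihrauch_le_Bold_Empty: "f \<le>\<^sub>W Bold_Empty"
  using computable_empty by (auto simp: weihrauch_le_def)

lemma medvedev_imp_weihrauch:
  assumes "A \<le>\<^sub>M B"
  shows "const_mv A \<le>\<^sub>W const_mv B"
proof (cases "B = {}")
  case True
  then show ?thesis
    by (simp add: const_mv_def weihrauch_le_Bold_Empty)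
next
  case False
  obtain F where F: "computable F" and "B \<subseteq> dom F" "\<forall>p\<in>B. \<forall>q. F p = Some q \<longrightarrow> q \<in> A"
    using assms by (auto simp: medvedev_le_def)
  then have FB: "\<exists>a\<in>A. F q = Some a" if "q \<in> B" for q
    using that by blast
  with False have "A \<noteq> {}"
    by blast
  have "(\<lambda>p. Option.bind ((G \<circ>\<^sub>m Some) p) (\<lambda>q. F (baire_snd (baire_pair p q))))
      \<in> mv_realizers (const_mv A)" if "G \<in> mv_realizers (const_mv B)" for G
  proof -
    have "\<exists>q\<in>B. G p = Some q" for p
      using that \<open>B \<noteq> {}\<close> by (simp add: const_mv_def)
    then have "\<exists>a\<in>A. Option.bind (G p) F = Some a" for p
      using FB by (metis bind.bind_lunit)
    with \<open>A \<noteq> {}\<close> show ?thesis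
      by (simp add: const_mv_def map_comp_def)
  qed
  with computable_comp_baire_snd[OF F] computable_Some show ?thesis
    unfolding weihrauch_le_def by blast
qed

lemma weihrauch_imp_medvedev:
  assumes "const_mv A \<le>\<^sub>W const_mv B"
  shows "A \<le>\<^sub>M B"
proof -
  obtain H K where H: "computable H" and
    HK: "\<And>G. G \<in> mv_realizers (const_mv B) \<Longrightarrow>
      (\<lambda>p. Option.bind ((G \<circ>\<^sub>m K) p) (\<lambda>q. H (baire_pair p q))) \<in> mv_realizers (const_mv A)"
    using assms unfolding weihrauch_le_def by blast
  have "\<exists>a\<in>A. H (baire_pair q q) = Some a" if q: "q \<in> B" for q
  proof -
    have "(\<lambda>_. Some q) \<in> mv_realizers (const_mv B)"
      using q by (auto simp: const_mv_def)
    \<comment> \<open>As \<open>const_mv A\<close> now has a realizer, \<open>A\<close> is not empty.\<close>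
    from HK[OF this] obtain a where "a \<in> A"
      "Option.bind (((\<lambda>_. Some q) \<circ>\<^sub>m K) q) (\<lambda>q'. H (baire_pair q q')) = Some a"
      by (auto simp: const_mv_def split: if_splits)
    then show ?thesis
      by (auto simp: map_comp_def split: option.splits)
  qed
  then show ?thesis
    using computable_comp_diagonal[OF H] unfolding medvedev_le_def
    by (intro exI[of _ "\<lambda>q. H (baire_pair q q)"]) fastforce
qed

theorem theorem5p1:
  fixes A B :: "(nat \<Rightarrow> nat) set"
  shows "A \<le>\<^sub>M B \<longleftrightarrow> const_mv A \<le>\<^sub>W const_mv B"
  using medvedev_imp_weihrauch weihrauch_imp_medvedev by blast

end
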